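(* Let $\mathcal{C}=(C,d)$ be a finite chain complex of free abelian groups of dimension $n$, with $C=\{C_q\}$, $C_q$ a basis of $\mathcal{C}_q$. For every possible run of Algorithm L (described in the context) on $\mathcal{C}$ with integer coefficients, the output $((C,d),H,f,g,\phi,\lambda)$ is a $\lambda$-AT-model for $\mathcal{C}$.
   Context: A finite chain complex $\mathcal{C}$ is a sequence of finitely generated free abelian groups $\mathcal{C}_q$ ($0\le q\le n$, $\mathcal{C}_q=0$ otherwise) with homomorphisms $d_q:\mathcal{C}_q\to\mathcal{C}_{q-1}$, $d_qd_{q+1}=0$. It is encoded as $(C,d)$, where $C=\{C_q\}$ and $C_q$ is a finite basis of $\mathcal{C}_q$. For a basis element $a$ and a chain $b$ in the same degree, $\langle b,a\rangle$ is the coefficient of $a$ in $b$. A $\lambda$-chain contraction ($\lambda\in\mathbf{Z}$, $\lambda\ne0$) of $(\mathcal{C},d)$ to $(\mathcal{C}',d')$ is a set $(f,g,\phi,\lambda)$ with $f:\mathcal{C}\to\mathcal{C}'$ and $g:\mathcal{C}'\to\mathcal{C}$ chain maps and $\phi=\{\phi_q:\mathcal{C}_q\to\mathcal{C}_{q+1}\}$ homomorphisms such that $fg=\lambda\, id_{\mathcal{C}'}$ and $\lambda\, id_{\mathcal{C}}-gf=\phi d+d\phi$. A $\lambda$-AT-model for $\mathcal{C}=(C,d)$ is a set $((C,d),H,f,g,\phi,\lambda)$ where $\lambda$ is a non-zero integer, $H=\{H_q\}$ is a graded set freely generating a chain complex $\mathcal{H}$ with zero differential, and $(f,g,\phi,\lambda)$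 is a $\lambda$-chain contraction of $\mathcal{C}$ to $\mathcal{H}$. Algorithm L (all maps are given on basis elements and extended linearly; choices are arbitrary among those allowed). Initialise $H_0:=C_0$, $A:=C_0$, $\lambda:=1$, $f_0:=id$, $g_0:=id$, $\phi_0:=0$. For $q=1,\dots,n$ do: (1) Set $H_q:=\emptyset$. While the set $M:=\{|\langle f_{q-1}d_q(c),c'\rangle|\neq 0 : c\in C_q,\ c'\in H_{q-1}\}$ is non-empty: choose $\alpha\in H_{q-1}$ and $\beta\in C_q$ with $|\langle f_{q-1}d_q(\beta),\alpha\rangle|=\min M$. Set $H_{q-1}:=H_{q-1}\setminus\{\alpha\}$, $A:=A\cup\{\beta\}$, $f_q(\beta):=0$, $\phi_q(\beta):=0$, and (with the current values of the maps and of $\lambda$) $x:=\langle f_{q-1}d_q(\beta),\alpha\rangle$, $\gamma:=f_{q-1}d_q(\beta)$, $\gamma':=\lambda\beta-\phi_{q-1}d_q(\beta)$. Then for every $b\in C_r$, $0\le r\le q-1$, replace simultaneously $f_r(b)$ by $x f_r(b)-\langle f_r(b),\alpha\rangle\gamma$ and $\phi_r(b)$ by $x\phi_r(b)+\langle f_r(b),\alpha\rangle\gamma'$, where the values on the right-hand sides are the old ones (and $\langle f_r(b),\alpha\rangle=0$ if $r\neq q-1$). Finally set $\lambda:=x\lambda$. (2) When $M$ is empty: for each $a\in C_q\setminus A$ set $H_q:=H_q\cup\{a\}$, $A:=A\cup\{a\}$, $f_q(a):=a$, $g_q(a):=\lambda a-\phi_{q-1}d_q(a)$, $\phi_q(a):=0$.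 Output: $((C,d),H,f,g,\phi,\lambda)$ with the final values, $H=\{H_q\}_{0\le q\le n}$, and each $g_q$ restricted to the final $H_q$. *)

theory Defs
  imports "HOL-Algebra.Free_Abelian_Groups"
begin

(* Chains are formal integer combinations of basis elements.  Chains of different degrees are
   told apart by the degree index only, so the sets C q need not be disjoint. *)
abbreviation chains :: "(nat \<Rightarrow> 'a set) \<Rightarrow> nat \<Rightarrow> ('a \<Rightarrow>\<^sub>0 int) monoid" where
  "chains C q \<equiv> free_Abelian_group (C q)"

(* The target of d 0 should be the zero group in degree -1.  As 0 - 1 = 0 on nat, d 0 has codomain
   chains C 0 here and is required to vanish instead.  With this convention the equations
   below, which mention degree q - 1, are trivially correct for q = 0. *)
definition finite_chain_complex ::
    "nat \<Rightarrow> (nat \<Rightarrow> 'a set) \<Rightarrow> (nat \<Rightarrow> ('a \<Rightarrow>\<^sub>0 int) \<Rightarrow> ('a \<Rightarrow>\<^sub>0 int)) \<Rightarrow> bool" where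
  "finite_chain_complex n C d \<longleftrightarrow>
     (\<forall>q. finite (C q)) \<and> (\<forall>q>n. C q = {}) \<and>
     (\<forall>q. d q \<in> hom (chains C q) (chains C (q - 1))) \<and>
     (\<forall>c\<in>carrier (chains C 0). d 0 c = 0) \<and>
     (\<forall>q. \<forall>c\<in>carrier (chains C (Suc q)). d q (d (Suc q) c) = 0)"

definition chain_map ::
    "(nat \<Rightarrow> 'a set) \<Rightarrow> (nat \<Rightarrow> ('a \<Rightarrow>\<^sub>0 int) \<Rightarrow> ('a \<Rightarrow>\<^sub>0 int)) \<Rightarrow>
     (nat \<Rightarrow> 'b set) \<Rightarrow> (nat \<Rightarrow> ('b \<Rightarrow>\<^sub>0 int) \<Rightarrow> ('b \<Rightarrow>\<^sub>0 int)) \<Rightarrow>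
     (nat \<Rightarrow> ('a \<Rightarrow>\<^sub>0 int) \<Rightarrow> ('b \<Rightarrow>\<^sub>0 int)) \<Rightarrow> bool" where
  "chain_map C d C' d' f \<longleftrightarrow>
     (\<forall>q. f q \<in> hom (chains C q) (chains C' q)) \<and>
     (\<forall>q. \<forall>c\<in>carrier (chains C q). f (q - 1) (d q c) = d' q (f q c))"

definition chain_contraction ::
    "(nat \<Rightarrow> 'a set) \<Rightarrow> (nat \<Rightarrow> ('a \<Rightarrow>\<^sub>0 int) \<Rightarrow> ('a \<Rightarrow>\<^sub>0 int)) \<Rightarrow>
     (nat \<Rightarrow> 'b set) \<Rightarrow> (nat \<Rightarrow> ('b \<Rightarrow>\<^sub>0 int) \<Rightarrow> ('b \<Rightarrow>\<^sub>0 int)) \<Rightarrow>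
     (nat \<Rightarrow> ('a \<Rightarrow>\<^sub>0 int) \<Rightarrow> ('b \<Rightarrow>\<^sub>0 int)) \<Rightarrow> (nat \<Rightarrow> ('b \<Rightarrow>\<^sub>0 int) \<Rightarrow> ('a \<Rightarrow>\<^sub>0 int)) \<Rightarrow>
     (nat \<Rightarrow> ('a \<Rightarrow>\<^sub>0 int) \<Rightarrow> ('a \<Rightarrow>\<^sub>0 int)) \<Rightarrow> int \<Rightarrow> bool" where
  "chain_contraction C d C' d' f g \<phi> l \<longleftrightarrow>
     l \<noteq> 0 \<and> chain_map C d C' d' f \<and> chain_map C' d' C d g \<and>
     (\<forall>q. \<phi> q \<in> hom (chains C q) (chains C (q + 1))) \<and>
     (\<forall>q. \<forall>c\<in>carrier (chains C' q). f q (g q c) = frag_cmul l c) \<and>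
     (\<forall>q. \<forall>c\<in>carrier (chains C q).
        frag_cmul l c - g q (f q c) = \<phi> (q - 1) (d q c) + d (q + 1) (\<phi> q c))"

definition AT_model ::
    "nat \<Rightarrow> (nat \<Rightarrow> 'a set) \<Rightarrow> (nat \<Rightarrow> ('a \<Rightarrow>\<^sub>0 int) \<Rightarrow> ('a \<Rightarrow>\<^sub>0 int)) \<Rightarrow> (nat \<Rightarrow> 'b set) \<Rightarrow>
     (nat \<Rightarrow> ('a \<Rightarrow>\<^sub>0 int) \<Rightarrow> ('b \<Rightarrow>\<^sub>0 int)) \<Rightarrow> (nat \<Rightarrow> ('b \<Rightarrow>\<^sub>0 int) \<Rightarrow> ('a \<Rightarrow>\<^sub>0 int)) \<Rightarrow>
     (nat \<Rightarrow> ('a \<Rightarrow>\<^sub>0 int) \<Rightarrow> ('a \<Rightarrow>\<^sub>0 int)) \<Rightarrow> int \<Rightarrow> bool" where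
  "AT_model n C d H f g \<phi> l \<longleftrightarrow>
     finite_chain_complex n C d \<and> finite_chain_complex n H (\<lambda>q c. 0) \<and>
     chain_contraction C d H (\<lambda>q c. 0) f g \<phi> l"

(* A state of the algorithm.  The maps are stored by their values on basis elements.  Values
   not assigned so far are stored as 0; the algorithm does not read them.  The set A of treated
   basis elements is graded, so that it works without disjointness of the bases. *)
record 'a algL_state =
  Hs :: "nat \<Rightarrow> 'a set"
  As :: "nat \<Rightarrow> 'a set"
  lam :: int
  fs :: "nat \<Rightarrow> 'a \<Rightarrow> ('a \<Rightarrow>\<^sub>0 int)"
  gs :: "nat \<Rightarrow> 'a \<Rightarrow> ('a \<Rightarrow>\<^sub>0 int)"
  phis :: "nat \<Rightarrow> 'a \<Rightarrow> ('a \<Rightarrow>\<^sub>0 int)"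

definition algL_init :: "(nat \<Rightarrow> 'a set) \<Rightarrow> 'a algL_state" where
  "algL_init C =
     \<lparr> Hs = (\<lambda>q. if q = 0 then C 0 else {}),
       As = (\<lambda>q. if q = 0 then C 0 else {}),
       lam = 1,
       fs = (\<lambda>q b. if q = 0 \<and> b \<in> C 0 then frag_of b else 0),
       gs = (\<lambda>q b. if q = 0 \<and> b \<in> C 0 then frag_of b else 0),
       phis = (\<lambda>q b. 0) \<rparr>"

(* The chain f_{q-1} d_q (b) for a basis element b of degree q. *)
definition algL_fd ::
    "(nat \<Rightarrow> ('a \<Rightarrow>\<^sub>0 int) \<Rightarrow> ('a \<Rightarrow>\<^sub>0 int)) \<Rightarrow> nat \<Rightarrow> 'a algL_state \<Rightarrow> 'a \<Rightarrow> ('a \<Rightarrow>\<^sub>0 int)" where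
  "algL_fd d q s b = frag_extend (fs s (q - 1)) (d q (frag_of b))"

(* The chain lambda b - phi_{q-1} d_q (b) for a basis element b of degree q. *)
definition algL_cycle ::
    "(nat \<Rightarrow> ('a \<Rightarrow>\<^sub>0 int) \<Rightarrow> ('a \<Rightarrow>\<^sub>0 int)) \<Rightarrow> nat \<Rightarrow> 'a algL_state \<Rightarrow> 'a \<Rightarrow> ('a \<Rightarrow>\<^sub>0 int)" where
  "algL_cycle d q s b =
     frag_cmul (lam s) (frag_of b) - frag_extend (phis s (q - 1)) (d q (frag_of b))"

definition algL_M ::
    "(nat \<Rightarrow> 'a set) \<Rightarrow> (nat \<Rightarrow> ('a \<Rightarrow>\<^sub>0 int) \<Rightarrow> ('a \<Rightarrow>\<^sub>0 int)) \<Rightarrow> nat \<Rightarrow> 'a algL_state \<Rightarrow> int set" where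
  "algL_M C d q s =
     {\<bar>Poly_Mapping.lookup (algL_fd d q s c) c'\<bar> | c c'.
        c \<in> C q \<and> c' \<in> Hs s (q - 1) \<and> \<bar>Poly_Mapping.lookup (algL_fd d q s c) c'\<bar> \<noteq> 0}"

definition algL_clear :: "nat \<Rightarrow> 'a algL_state \<Rightarrow> 'a algL_state" where
  "algL_clear q s = s\<lparr> Hs := (Hs s)(q := {}) \<rparr>"

definition algL_eliminate ::
    "(nat \<Rightarrow> 'a set) \<Rightarrow> (nat \<Rightarrow> ('a \<Rightarrow>\<^sub>0 int) \<Rightarrow> ('a \<Rightarrow>\<^sub>0 int)) \<Rightarrow> nat \<Rightarrow> 'a \<Rightarrow> 'a \<Rightarrow>
     'a algL_state \<Rightarrow> 'a algL_state" where
  "algL_eliminate C d q \<alpha> \<beta> s =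
     (let x = Poly_Mapping.lookup (algL_fd d q s \<beta>) \<alpha>;
          \<gamma> = algL_fd d q s \<beta>;
          \<gamma>' = algL_cycle d q s \<beta>;
          y = (\<lambda>r b. if r = q - 1 then Poly_Mapping.lookup (fs s r b) \<alpha> else 0)
      in s\<lparr> Hs := (Hs s)(q - 1 := Hs s (q - 1) - {\<alpha>}),
            As := (As s)(q := insert \<beta> (As s q)),
            fs := (\<lambda>r b. if r \<le> q - 1 \<and> b \<in> C r then frag_cmul x (fs s r b) - frag_cmul (y r b) \<gamma>
                          else if r = q \<and> b = \<beta> then 0
                          else fs s r b),
            phis := (\<lambda>r b. if r \<le> q - 1 \<and> b \<in> C r then frag_cmul x (phis s r b) + frag_cmul (y r b) \<gamma>'
                            else if r = q \<and> b = \<beta> then 0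
                            else phis s r b),
            lam := x * lam s \<rparr>)"

inductive algL_step ::
    "(nat \<Rightarrow> 'a set) \<Rightarrow> (nat \<Rightarrow> ('a \<Rightarrow>\<^sub>0 int) \<Rightarrow> ('a \<Rightarrow>\<^sub>0 int)) \<Rightarrow> nat \<Rightarrow>
     'a algL_state \<Rightarrow> 'a algL_state \<Rightarrow> bool"
  for C d q where
  "\<lbrakk> algL_M C d q s \<noteq> {}; \<alpha> \<in> Hs s (q - 1); \<beta> \<in> C q;
     \<bar>Poly_Mapping.lookup (algL_fd d q s \<beta>) \<alpha>\<bar> = Min (algL_M C d q s) \<rbrakk>
   \<Longrightarrow> algL_step C d q s (algL_eliminate C d q \<alpha> \<beta> s)"

(* The new values assigned to one a do not depend on those assigned to the others, so all a in
   C q - A can be treated at once. *)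
definition algL_adjoin ::
    "(nat \<Rightarrow> 'a set) \<Rightarrow> (nat \<Rightarrow> ('a \<Rightarrow>\<^sub>0 int) \<Rightarrow> ('a \<Rightarrow>\<^sub>0 int)) \<Rightarrow> nat \<Rightarrow>
     'a algL_state \<Rightarrow> 'a algL_state" where
  "algL_adjoin C d q s =
     (let N = C q - As s q
      in s\<lparr> Hs := (Hs s)(q := Hs s q \<union> N),
            As := (As s)(q := As s q \<union> N),
            fs := (\<lambda>r b. if r = q \<and> b \<in> N then frag_of b else fs s r b),
            gs := (\<lambda>r b. if r = q \<and> b \<in> N then algL_cycle d q s b else gs s r b),
            phis := (\<lambda>r b. if r = q \<and> b \<in> N then 0 else phis s r b) \<rparr>)"

(* algL_run C d q s: s can be the state after initialisation and the passes 1, ..., q. *)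
inductive algL_run ::
    "(nat \<Rightarrow> 'a set) \<Rightarrow> (nat \<Rightarrow> ('a \<Rightarrow>\<^sub>0 int) \<Rightarrow> ('a \<Rightarrow>\<^sub>0 int)) \<Rightarrow> nat \<Rightarrow> 'a algL_state \<Rightarrow> bool"
  for C d where
  init: "algL_run C d 0 (algL_init C)"
| pass: "\<lbrakk> algL_run C d (q - 1) s; q \<ge> 1;
           (algL_step C d q)\<^sup>*\<^sup>* (algL_clear q s) s'; algL_M C d q s' = {} \<rbrakk>
         \<Longrightarrow> algL_run C d q (algL_adjoin C d q s')"

(* Output of a run.  On each degree only the values of frag_extend on chains supported in
   C q (for f and phi) or in Hs s q (for g) matter. *)
definition algL_output ::
    "nat \<Rightarrow> (nat \<Rightarrow> 'a set) \<Rightarrow> (nat \<Rightarrow> ('a \<Rightarrow>\<^sub>0 int) \<Rightarrow> ('a \<Rightarrow>\<^sub>0 int)) \<Rightarrow> (nat \<Rightarrow> 'a set) \<Rightarrow>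
     (nat \<Rightarrow> ('a \<Rightarrow>\<^sub>0 int) \<Rightarrow> ('a \<Rightarrow>\<^sub>0 int)) \<Rightarrow> (nat \<Rightarrow> ('a \<Rightarrow>\<^sub>0 int) \<Rightarrow> ('a \<Rightarrow>\<^sub>0 int)) \<Rightarrow>
     (nat \<Rightarrow> ('a \<Rightarrow>\<^sub>0 int) \<Rightarrow> ('a \<Rightarrow>\<^sub>0 int)) \<Rightarrow> int \<Rightarrow> bool" where
  "algL_output n C d H f g \<phi> l \<longleftrightarrow>
     (\<exists>s. algL_run C d n s \<and> H = Hs s \<and> f = (\<lambda>q. frag_extend (fs s q)) \<and>
          g = (\<lambda>q. frag_extend (gs s q)) \<and> \<phi> = (\<lambda>q. frag_extend (phis s q)) \<and> l = lam s)"

(* The while loop cannot run forever: each step shrinks the finite set Hs s (q - 1). *)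
lemma algL_step_psubset: "algL_step C d q s s' \<Longrightarrow> Hs s' (q - 1) \<subset> Hs s (q - 1)"
  by (auto elim!: algL_step.cases simp: algL_eliminate_def Let_def)

lemma algL_loop_exists:
  assumes "finite (C q)" "finite (Hs s (q - 1))"
  shows "\<exists>s'. (algL_step C d q)\<^sup>*\<^sup>* s s' \<and> algL_M C d q s' = {}"
  using assms(2)
proof (induction "card (Hs s (q - 1))" arbitrary: s rule: less_induct)
  case less
  show ?case
  proof (cases "algL_M C d q s = {}")
    case False
    have "algL_M C d q s \<subseteq>
        (\<lambda>(c, c'). \<bar>Poly_Mapping.lookup (algL_fd d q s c) c'\<bar>) ` (C q \<times> Hs s (q - 1))"
      unfolding algL_M_def by auto
    then have "finite (algL_M C d q s)"
      using assms(1) less.prems by (meson finite_SigmaI finite_imageI finite_subset)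
    then have "Min (algL_M C d q s) \<in> algL_M C d q s"
      using False by simp
    then obtain \<alpha> \<beta> where "\<alpha> \<in> Hs s (q - 1)" "\<beta> \<in> C q"
        "\<bar>Poly_Mapping.lookup (algL_fd d q s \<beta>) \<alpha>\<bar> = Min (algL_M C d q s)"
      unfolding algL_M_def by auto
    then have st: "algL_step C d q s (algL_eliminate C d q \<alpha> \<beta> s)" (is "algL_step _ _ _ _ ?t")
      using False by (intro algL_step.intros)
    then have "Hs ?t (q - 1) \<subset> Hs s (q - 1)" by (rule algL_step_psubset)
    then have "\<exists>s'. (algL_step C d q)\<^sup>*\<^sup>* ?t s' \<and> algL_M C d q s' = {}"
      using less by (meson finite_subset psubset_card_mono psubset_imp_subset)
    then show ?thesis using st by (meson converse_rtranclp_into_rtranclp)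
  qed blast
qed

lemma algL_output_exists:
  assumes "finite_chain_complex n C d"
  shows "\<exists>H f g \<phi> l. algL_output n C d H f g \<phi> l"
proof -
  have fin: "finite (C q)" for q
    using assms by (simp add: finite_chain_complex_def)
  have "\<exists>s. algL_run C d q s \<and> finite (Hs s q)" for q
  proof (induction q)
    case 0
    have "finite (Hs (algL_init C) 0)"
      using fin by (simp add: algL_init_def)
    then show ?case using algL_run.init by blast
  next
    case (Suc q)
    then obtain s where s: "algL_run C d q s" "finite (Hs s q)" by blast
    then obtain s' where s': "(algL_step C d (Suc q))\<^sup>*\<^sup>* (algL_clear (Suc q) s) s'"
        "algL_M C d (Suc q) s' = {}"
      using algL_loop_exists[of C "Suc q" "algL_clear (Suc q) s" d] fin
      by (auto simp: algL_clear_def)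
    have "Hs s' (Suc q) = {}"
      using s'(1)
    proof (induction rule: rtranclp_induct)
      case base
      then show ?case by (simp add: algL_clear_def)
    next
      case (step t t')
      then show ?case by (auto elim!: algL_step.cases simp: algL_eliminate_def Let_def)
    qed
    then have "finite (Hs (algL_adjoin C d (Suc q) s') (Suc q))"
      using fin by (simp add: algL_adjoin_def Let_def)
    moreover have "algL_run C d (Suc q) (algL_adjoin C d (Suc q) s')"
      using s s' by (intro algL_run.pass) auto
    ultimately show ?case by blast
  qed
  then show ?thesis unfolding algL_output_def by blast
qed

end

theory Submission
  imports Defs
begin

(* A single invariant holds between passes and inside the while loop.  Inside the loop of pass q
   the elements b of A in degree q satisfy f b = 0, phi b = 0, f d b = 0 and phi d b = lambda b; the
   values of phi_{q-1} are chains in them, which gives f phi = 0.  Eliminating beta multiplies the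
   homotopy equation by x and adds the same multiple of g f d beta = d (lambda beta - phi d beta) to
   both sides.  The map g is never rescaled: fg = lambda survives because f_{q-1} g_{q-1} is
   multiplied by x on the basis elements other than alpha.  Once M is empty, f d = 0 in degree q, so
   the chains lambda a - phi d a of the remaining basis elements a of degree q are cycles. *)

section \<open>Linear extension of maps given on basis elements\<close>

lemma frag_cmul_diff_distrib2: "frag_cmul c (a - b) = frag_cmul c a - frag_cmul c b"
  by (simp add: poly_mapping_eqI lookup_minus right_diff_distrib)

lemma keys_cmul_subset:
  "Poly_Mapping.keys c \<subseteq> S \<Longrightarrow> Poly_Mapping.keys (frag_cmul k c) \<subseteq> S"
  using keys_cmul by blast

lemma keys_frag_extend_subset:
  assumes "\<And>b. b \<in> Poly_Mapping.keys c \<Longrightarrow> Poly_Mapping.keys (f b) \<subseteq> T"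
  shows "Poly_Mapping.keys (frag_extend f c) \<subseteq> T"
  using assms keys_frag_extend[of f c] by blast

lemma frag_extend_frag_extend:
  "frag_extend f (frag_extend g c) = frag_extend (\<lambda>b. frag_extend f (g b)) c"
  by (induction c rule: frag_induction[OF subset_UNIV]) (simp_all add: frag_extend_diff)

lemma frag_extend_diff_fun:
  "frag_extend (\<lambda>b. f b - g b) c = frag_extend f c - frag_extend g c"
  by (induction c rule: frag_induction[OF subset_UNIV]) (simp_all add: frag_extend_diff)

lemma frag_extend_add_fun:
  "frag_extend (\<lambda>b. f b + g b) c = frag_extend f c + frag_extend g c"
  by (induction c rule: frag_induction[OF subset_UNIV]) (simp_all add: frag_extend_diff)

lemma frag_extend_cmul_fun:
  "frag_extend (\<lambda>b. frag_cmul k (f b)) c = frag_cmul k (frag_extend f c)"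
  by (induction c rule: frag_induction[OF subset_UNIV])
    (simp_all add: frag_extend_diff frag_cmul_diff_distrib2)

text \<open>The correction term of an elimination has as factor the coefficient of \<alpha> in the
  value at \<open>b\<close>, which varies with \<open>b\<close>. Taking a coefficient is linear, so
  extending the term linearly evaluates this factor on the whole chain.\<close>

lemma frag_extend_lookup_fun:
  "frag_extend (\<lambda>b. frag_cmul (Poly_Mapping.lookup (f b) a) v) c
     = frag_cmul (Poly_Mapping.lookup (frag_extend f c) a) v"
  by (induction c rule: frag_induction[OF subset_UNIV])
    (simp_all add: frag_extend_diff frag_cmul_diff_distrib lookup_minus)

lemma frag_extend_cmul_of: "frag_extend (\<lambda>b. frag_cmul k (frag_of b)) c = frag_cmul k c"
  using frag_expansion[of c] by (simp add: frag_extend_cmul_fun)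

text \<open>A linear extension is additive by construction, so only supports are at issue.\<close>

lemma frag_extend_in_hom:
  assumes "\<And>c. Poly_Mapping.keys c \<subseteq> S \<Longrightarrow> Poly_Mapping.keys (frag_extend f c) \<subseteq> T"
  shows "frag_extend f \<in> hom (free_Abelian_group S) (free_Abelian_group T)"
  using assms by (intro homI) (simp_all add: frag_extend_add)

lemma hom_frag_expand:
  assumes "h \<in> hom (free_Abelian_group S) (free_Abelian_group T)" "Poly_Mapping.keys c \<subseteq> S"
  shows "h c = frag_extend (\<lambda>b. h (frag_of b)) c"
proof -
  have zero: "h 0 = 0"
    using hom_frag_diff[OF assms(1), of 0 0] by simp
  \<comment> \<open>The support is carried through the induction because \<open>h\<close> is
    additive only on chains supported in \<open>S\<close>.\<close>
  have step: "h (a - b) = frag_extend (\<lambda>b. h (frag_of b)) (a - b) \<and> Poly_Mapping.keys (a - b) \<subseteq> S"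
    if "h a = frag_extend (\<lambda>b. h (frag_of b)) a \<and> Poly_Mapping.keys a \<subseteq> S"
      "h b = frag_extend (\<lambda>b. h (frag_of b)) b \<and> Poly_Mapping.keys b \<subseteq> S" for a b
    using that hom_frag_diff[OF assms(1), of a b] keys_diff[of a b] by (auto simp: frag_extend_diff)
  have "h c = frag_extend (\<lambda>b. h (frag_of b)) c \<and> Poly_Mapping.keys c \<subseteq> S"
    using assms(2)
    by (induction c rule: frag_induction) (use zero step in auto)
  then show ?thesis by blast
qed

section \<open>The boundary as a linear map on supported chains\<close>

locale based_complex =
  fixes n :: nat and C :: "nat \<Rightarrow> 'a set" and d :: "nat \<Rightarrow> ('a \<Rightarrow>\<^sub>0 int) \<Rightarrow> ('a \<Rightarrow>\<^sub>0 int)"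
  assumes complex: "finite_chain_complex n C d"
begin

lemma d_hom: "d r \<in> hom (chains C r) (chains C (r - 1))"
  using complex by (simp add: finite_chain_complex_def)

lemma d_keys:
  assumes "Poly_Mapping.keys c \<subseteq> C r"
  shows "Poly_Mapping.keys (d r c) \<subseteq> C (r - 1)"
  using hom_in_carrier[OF d_hom, of c r] assms by simp

lemma d_0: "Poly_Mapping.keys c \<subseteq> C 0 \<Longrightarrow> d 0 c = 0"
  using complex by (simp add: finite_chain_complex_def)

lemma d_d: "Poly_Mapping.keys c \<subseteq> C (Suc r) \<Longrightarrow> d r (d (Suc r) c) = 0"
  using complex by (simp add: finite_chain_complex_def)

lemma d_expand: "Poly_Mapping.keys c \<subseteq> C r \<Longrightarrow> d r c = frag_extend (\<lambda>b. d r (frag_of b)) c"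
  by (rule hom_frag_expand[OF d_hom])

lemma d_zero: "d r 0 = 0"
  using d_expand[of 0 r] by simp

lemma d_diff:
  assumes "Poly_Mapping.keys a \<subseteq> C r" "Poly_Mapping.keys b \<subseteq> C r"
  shows "d r (a - b) = d r a - d r b"
  using hom_frag_diff[OF d_hom] assms by blast

lemma d_add:
  assumes "Poly_Mapping.keys a \<subseteq> C r" "Poly_Mapping.keys b \<subseteq> C r"
  shows "d r (a + b) = d r a + d r b"
  using hom_frag_add[OF d_hom] assms by blast

lemma d_cmul:
  assumes "Poly_Mapping.keys c \<subseteq> C r"
  shows "d r (frag_cmul k c) = frag_cmul k (d r c)"
  using d_expand[of "frag_cmul k c" r] d_expand[of c r] assms keys_cmul_subset[of c "C r" k]
  by (simp add: frag_extend_cmul)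

end

(* The state s after pass q or inside the loop of pass q + 1. *)
locale algL_invariant = based_complex n C d
  for n and C :: "nat \<Rightarrow> 'a set" and d +
  fixes q :: nat and s :: "'a algL_state"
  assumes lam_nonzero: "lam s \<noteq> 0"
    and Hs_subset: "Hs s r \<subseteq> C r"
    and Hs_above: "q < r \<Longrightarrow> Hs s r = {}"
    and As_subset: "As s (Suc q) \<subseteq> C (Suc q)"
    and As_above: "Suc q < r \<Longrightarrow> As s r = {}"
    and fs_above: "q < r \<Longrightarrow> fs s r b = 0"
    and phis_above: "q < r \<Longrightarrow> phis s r b = 0"
    and f_keys: "Poly_Mapping.keys c \<subseteq> C r \<Longrightarrow>
      Poly_Mapping.keys (frag_extend (fs s r) c) \<subseteq> Hs s r"
    and g_keys: "Poly_Mapping.keys c \<subseteq> Hs s r \<Longrightarrow>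
      Poly_Mapping.keys (frag_extend (gs s r) c) \<subseteq> C r"
    and phi_keys: "Poly_Mapping.keys c \<subseteq> C r \<Longrightarrow>
      Poly_Mapping.keys (frag_extend (phis s r) c) \<subseteq> C (Suc r)"
    and phi_keys_As: "Poly_Mapping.keys c \<subseteq> C q \<Longrightarrow>
      Poly_Mapping.keys (frag_extend (phis s q) c) \<subseteq> As s (Suc q)"
    and f_phi: "Poly_Mapping.keys c \<subseteq> C r \<Longrightarrow>
      frag_extend (fs s (Suc r)) (frag_extend (phis s r) c) = 0"
    and f_d: "\<lbrakk>r < q; Poly_Mapping.keys c \<subseteq> C (Suc r)\<rbrakk> \<Longrightarrow>
      frag_extend (fs s r) (d (Suc r) c) = 0"
    and f_g: "Poly_Mapping.keys c \<subseteq> Hs s r \<Longrightarrow>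
      frag_extend (fs s r) (frag_extend (gs s r) c) = frag_cmul (lam s) c"
    and d_g: "Poly_Mapping.keys c \<subseteq> Hs s r \<Longrightarrow> d r (frag_extend (gs s r) c) = 0"
    and homotopy: "\<lbrakk>r \<le> q; Poly_Mapping.keys c \<subseteq> C r\<rbrakk> \<Longrightarrow>
      frag_cmul (lam s) c - frag_extend (gs s r) (frag_extend (fs s r) c)
        = frag_extend (phis s (r - 1)) (d r c) + d (Suc r) (frag_extend (phis s r) c)"
    and f_d_As: "b \<in> As s (Suc q) \<Longrightarrow> frag_extend (fs s q) (d (Suc q) (frag_of b)) = 0"
    and phi_d_As: "b \<in> As s (Suc q) \<Longrightarrow>
      frag_extend (phis s q) (d (Suc q) (frag_of b)) = frag_cmul (lam s) (frag_of b)"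
begin

section \<open>Preservation of the invariant by the operations of a pass\<close>

lemma phi_above: "q < r \<Longrightarrow> frag_extend (phis s r) c = 0"
  by (simp add: frag_extend_eq_0 phis_above)

text \<open>The part \<phi> d b is a chain in eliminated elements by \<open>phi_keys_As\<close>.
  Hence adding multiples of this chain to \<phi> keeps its values inside A once \<open>b\<close> has
  been put into A.\<close>

lemma cycle_keys:
  assumes "b \<in> C (Suc q)"
  shows "Poly_Mapping.keys (algL_cycle d (Suc q) s b)
    \<subseteq> insert b (As s (Suc q))"
proof -
  have "Poly_Mapping.keys (frag_extend (phis s q) (d (Suc q) (frag_of b))) \<subseteq> As s (Suc q)"
    using assms d_keys[of "frag_of b" "Suc q"] by (intro phi_keys_As) simp
  then show ?thesis
    using keys_diff unfolding algL_cycle_def by fastforce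
qed

text \<open>This is the homotopy equation in degree \<open>q\<close>, applied to d b: its term
  \<phi> d d b vanishes. It identifies what an elimination adds to d \<phi>.\<close>

lemma d_cycle:
  assumes "b \<in> C (Suc q)"
  shows "d (Suc q) (algL_cycle d (Suc q) s b)
    = frag_extend (gs s q) (frag_extend (fs s q) (d (Suc q) (frag_of b)))"
proof -
  let ?c = "d (Suc q) (frag_of b)"
  have b: "Poly_Mapping.keys (frag_of b) \<subseteq> C (Suc q)" and c: "Poly_Mapping.keys ?c \<subseteq> C q"
    using assms d_keys[of "frag_of b" "Suc q"] by auto
  have "d (Suc q) (algL_cycle d (Suc q) s b)
      = frag_cmul (lam s) ?c - d (Suc q) (frag_extend (phis s q) ?c)"
    using b phi_keys[OF c] keys_cmul_subset[OF b]
    by (simp add: algL_cycle_def d_diff d_cmul)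
  moreover have "frag_extend (phis s (q - 1)) (d q ?c) = 0"
    using d_d[OF b] by simp
  ultimately show ?thesis
    using homotopy[OF order_refl c] by (simp add: algebra_simps)
qed

text \<open>On chains the new maps are f' = x f - y \<gamma> and \<phi>' = x \<phi> + y \<gamma>',
  where y(c) is the coefficient of \<alpha> in f(c). Below degree \<open>q\<close> they are plain
  multiples by x, so each clause reduces to the old one and the effect of y in degree
  \<open>q\<close>.\<close>

lemma eliminate:
  assumes \<alpha>: "\<alpha> \<in> Hs s q" and \<beta>: "\<beta> \<in> C (Suc q)"
    and x_nonzero: "Poly_Mapping.lookup (algL_fd d (Suc q) s \<beta>) \<alpha> \<noteq> 0"
  shows "algL_invariant n C d q (algL_eliminate C d (Suc q) \<alpha> \<beta> s)"
proof -
  define s' where "s' = algL_eliminate C d (Suc q) \<alpha> \<beta> s"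
  define x where "x = Poly_Mapping.lookup (algL_fd d (Suc q) s \<beta>) \<alpha>"
  define \<gamma> where "\<gamma> = algL_fd d (Suc q) s \<beta>"
  define \<gamma>' where "\<gamma>' = algL_cycle d (Suc q) s \<beta>"
  define y where "y r c = (if r = q then Poly_Mapping.lookup (frag_extend (fs s r) c) \<alpha> else 0)"
    for r c
  have x\<gamma>: "x = Poly_Mapping.lookup \<gamma> \<alpha>"
    by (simp add: x_def \<gamma>_def)
  have \<gamma>: "\<gamma> = frag_extend (fs s q) (d (Suc q) (frag_of \<beta>))"
    by (simp add: \<gamma>_def algL_fd_def)
  have s': "lam s' = x * lam s" "gs s' = gs s"
      "Hs s' = (Hs s)(q := Hs s q - {\<alpha>})" "As s' = (As s)(Suc q := insert \<beta> (As s (Suc q)))"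
    by (simp_all add: s'_def algL_eliminate_def x_def Let_def)
  have fs': "fs s' r b = frag_cmul x (fs s r b) - frag_cmul (y r (frag_of b)) \<gamma>"
    if "r \<le> q" "b \<in> C r" for r b
    using that by (simp add: s'_def algL_eliminate_def x_def Let_def y_def \<gamma>_def)
  have phis': "phis s' r b = frag_cmul x (phis s r b) + frag_cmul (y r (frag_of b)) \<gamma>'"
    if "r \<le> q" "b \<in> C r" for r b
    using that by (simp add: s'_def algL_eliminate_def x_def Let_def y_def \<gamma>'_def)
  have fs0': "fs s' r b = 0" if "q < r" for r b
    using that fs_above by (simp add: s'_def algL_eliminate_def Let_def)
  have phis0': "phis s' r b = 0" if "q < r" for r b
    using that phis_above by (simp add: s'_def algL_eliminate_def Let_def)
  have f0': "frag_extend (fs s' r) c = 0" if "q < r" for r c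
    using that fs0' by (simp add: frag_extend_eq_0)
  have phi0': "frag_extend (phis s' r) c = 0" if "q < r" for r c
    using that phis0' by (simp add: frag_extend_eq_0)
  have y: "frag_extend (\<lambda>b. frag_cmul (y r (frag_of b)) v) c = frag_cmul (y r c) v" for r c v
    by (simp add: y_def frag_extend_lookup_fun frag_extend_eq_0)
  have f': "frag_extend (fs s' r) c = frag_cmul x (frag_extend (fs s r) c) - frag_cmul (y r c) \<gamma>"
    if "r \<le> q" "Poly_Mapping.keys c \<subseteq> C r" for r c
  proof -
    have "frag_extend (fs s' r) c
        = frag_extend (\<lambda>b. frag_cmul x (fs s r b) - frag_cmul (y r (frag_of b)) \<gamma>) c"
      using that by (intro frag_extend_eq fs') auto
    then show ?thesis
      by (simp add: frag_extend_diff_fun frag_extend_cmul_fun y)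
  qed
  have phi': "frag_extend (phis s' r) c
      = frag_cmul x (frag_extend (phis s r) c) + frag_cmul (y r c) \<gamma>'"
    if "r \<le> q" "Poly_Mapping.keys c \<subseteq> C r" for r c
  proof -
    have "frag_extend (phis s' r) c
        = frag_extend (\<lambda>b. frag_cmul x (phis s r b) + frag_cmul (y r (frag_of b)) \<gamma>') c"
      using that by (intro frag_extend_eq phis') auto
    then show ?thesis
      by (simp add: frag_extend_add_fun frag_extend_cmul_fun y)
  qed
  \<comment> \<open>Wherever f vanishes the correction drops out, so old relations on such chains
    are only rescaled.\<close>
  have y0: "y r c = 0" if "frag_extend (fs s r) c = 0" for r c
    using that by (auto simp: y_def)
  have d\<beta>: "Poly_Mapping.keys (d (Suc q) (frag_of \<beta>)) \<subseteq> C q"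
    using d_keys[of "frag_of \<beta>" "Suc q"] \<beta> by simp
  have \<gamma>_keys: "Poly_Mapping.keys \<gamma> \<subseteq> Hs s q"
    unfolding \<gamma> using d\<beta> by (rule f_keys)
  have \<gamma>'_keys: "Poly_Mapping.keys \<gamma>' \<subseteq> insert \<beta> (As s (Suc q))"
    unfolding \<gamma>'_def using \<beta> by (rule cycle_keys)
  \<comment> \<open>The second support is constrained only for \<open>j \<noteq> 0\<close>: below
    degree \<open>q\<close> the factor of \<open>\<gamma>'\<close> is 0, while
    \<open>\<gamma>'\<close> itself lies in degree \<open>Suc q\<close>.\<close>
  have keys_lin: "Poly_Mapping.keys (frag_cmul i a + frag_cmul j b) \<subseteq> T"
    if "Poly_Mapping.keys a \<subseteq> T" "j \<noteq> 0 \<Longrightarrow> Poly_Mapping.keys b \<subseteq> T"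
    for i j a b and T :: "'a set"
    using that keys_add[of "frag_cmul i a" "frag_cmul j b"] by auto
  have y\<beta>: "y q (d (Suc q) (frag_of \<beta>)) = x"
    by (simp add: y_def x\<gamma> \<gamma>)
  have "algL_invariant n C d q s'"
  proof (unfold_locales, goal_cases)
    case 1
    show ?case using lam_nonzero x_nonzero by (simp add: s' x_def)
  next
    case (2 r)
    show ?case using Hs_subset[of r] by (auto simp: s')
  next
    case (3 r)
    then show ?case using Hs_above by (simp add: s')
  next
    case 4
    show ?case using As_subset \<beta> by (simp add: s')
  next
    case (5 r)
    then show ?case using As_above by (simp add: s')
  next
    case (6 r b)
    then show ?case by (rule fs0')
  next
    case (7 r b)
    then show ?case by (rule phis0')
  next
    case (8 c r)
    show ?case
    proof (cases "r \<le> q")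
      case True
      show ?thesis
      proof
        fix i assume "i \<in> Poly_Mapping.keys (frag_extend (fs s' r) c)"
        then have *: "x * Poly_Mapping.lookup (frag_extend (fs s r) c) i
            - y r c * Poly_Mapping.lookup \<gamma> i \<noteq> 0"
          by (simp add: f'[OF True 8] in_keys_iff lookup_minus)
        then have "i \<in> Poly_Mapping.keys (frag_extend (fs s r) c) \<or> r = q \<and> i \<in> Poly_Mapping.keys \<gamma>"
          by (auto simp: y_def in_keys_iff split: if_splits)
        then have "i \<in> Hs s r"
          using f_keys[OF 8] \<gamma>_keys by auto
        \<comment> \<open>At \<open>i = \<alpha>\<close> in degree \<open>q\<close> the two terms
          cancel: both are x times the coefficient of \<alpha> in f(c).\<close>
        moreover have "\<not> (r = q \<and> i = \<alpha>)"
          using * by (auto simp: y_def x\<gamma>)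
        ultimately show "i \<in> Hs s' r" by (auto simp: s')
      qed
    qed (simp add: f0')
  next
    case (9 c r)
    then have "Poly_Mapping.keys c \<subseteq> Hs s r" by (auto simp: s' split: if_splits)
    then show ?case unfolding s' by (rule g_keys)
  next
    case (10 c r)
    show ?case
    proof (cases "r \<le> q")
      case True
      have "y r c = 0 \<or> r = q" by (simp add: y_def)
      then show ?thesis
        unfolding phi'[OF True 10]
        using phi_keys[OF 10] \<gamma>'_keys As_subset \<beta> by (intro keys_lin) auto
    qed (simp add: phi0')
  next
    case (11 c)
    then show ?case
      unfolding phi'[OF order_refl 11]
      using phi_keys_As[OF 11] \<gamma>'_keys by (intro keys_lin) (auto simp: s')
  next
    case (12 c r)
    show ?case
    \<comment> \<open>For \<open>r \<ge> q\<close> the outer map has degree above \<open>q\<close>,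
      where all stored values of f are still 0.\<close>
    proof (cases "r < q")
      case True
      have "frag_extend (phis s' r) c = frag_cmul x (frag_extend (phis s r) c)"
        using phi'[OF less_imp_le[OF True] 12] True by (simp add: y_def)
      moreover have "frag_extend (fs s' (Suc r)) (frag_extend (phis s r) c) = 0"
        using f'[OF Suc_leI[OF True] phi_keys[OF 12]] f_phi[OF 12] y0 by simp
      ultimately show ?thesis by (simp add: frag_extend_cmul)
    qed (simp add: f0')
  next
    case (13 r c)
    have "Poly_Mapping.keys (d (Suc r) c) \<subseteq> C r"
      using d_keys[OF 13(2)] by simp
    then show ?case
      using f'[of r "d (Suc r) c"] f_d[OF 13] y0 13(1) by simp
  next
    case (14 c r)
    then have c: "Poly_Mapping.keys c \<subseteq> Hs s r" by (auto simp: s' split: if_splits)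
    show ?case
    proof (cases "r \<le> q")
      case True
      \<comment> \<open>In degree \<open>q\<close> the chain \<open>c\<close> no longer involves
        \<alpha>, so neither does f g c, which is a multiple of \<open>c\<close>.\<close>
      have "y r (frag_extend (gs s r) c) = 0"
        using 14 f_g[OF c] by (auto simp: y_def s' in_keys_iff)
      then show ?thesis
        using f'[OF True g_keys[OF c]] f_g[OF c] by (simp add: s')
    next
      case False
      then have "c = 0" using Hs_above[of r] c by simp
      then show ?thesis by simp
    qed
  next
    case (15 c r)
    then have "Poly_Mapping.keys c \<subseteq> Hs s r" by (auto simp: s' split: if_splits)
    then show ?case unfolding s' by (rule d_g)
  next
    case (16 r c)
    let ?F = "frag_extend (fs s r)" and ?G = "frag_extend (gs s r)"
      and ?P = "frag_extend (phis s r)"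
    have dc: "Poly_Mapping.keys (d r c) \<subseteq> C (r - 1)"
      using d_keys[OF 16(2)] .
    have 1: "frag_extend (phis s' (r - 1)) (d r c)
        = frag_cmul x (frag_extend (phis s (r - 1)) (d r c))"
    \<comment> \<open>For \<open>r > 0\<close> the degree \<open>r - 1\<close> is below
      \<open>q\<close>, where y is 0. For \<open>r = 0\<close> truncation gives
      \<open>r - 1 = 0\<close>, which may equal \<open>q\<close>; there d itself vanishes.\<close>
    proof (cases r)
      case 0
      then show ?thesis using d_0 16(2) by simp
    next
      case (Suc r')
      then show ?thesis
        using phi'[OF _ dc] 16(1) by (simp add: y_def)
    qed
    have \<gamma>'d: "d (Suc q) \<gamma>' = frag_extend (gs s q) \<gamma>" "Poly_Mapping.keys \<gamma>' \<subseteq> C (Suc q)"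
      using d_cycle[OF \<beta>] \<gamma>'_keys As_subset \<beta> by (auto simp: \<gamma>'_def \<gamma>)
    have 2: "d (Suc r) (frag_extend (phis s' r) c)
        = frag_cmul x (d (Suc r) (?P c)) + frag_cmul (y r c) (?G \<gamma>)"
    \<comment> \<open>The term \<open>?G \<gamma>\<close> is meaningful for \<open>r = q\<close>
      only; in other degrees its factor is 0.\<close>
    proof (cases "r = q")
      case True
      then show ?thesis
        unfolding phi'[OF 16]
        using phi_keys[OF 16(2)] \<gamma>'d 
        by (simp add: d_add d_cmul keys_cmul_subset)
    next
      case False
      then show ?thesis
        unfolding phi'[OF 16]
        using phi_keys[OF 16(2)] by (simp add: y_def d_cmul)
    qed
    have "frag_cmul (lam s') c - frag_extend (gs s' r) (frag_extend (fs s' r) c)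
        = frag_cmul x (frag_cmul (lam s) c - ?G (?F c)) + frag_cmul (y r c) (?G \<gamma>)"
      unfolding f'[OF 16]
      by (simp add: s' frag_extend_diff frag_extend_cmul frag_cmul_diff_distrib2)
    then show ?case
      unfolding homotopy[OF 16] 1 2 by (simp add: frag_cmul_distrib2 algebra_simps)
  next
    case (17 b)
    have db: "Poly_Mapping.keys (d (Suc q) (frag_of b)) \<subseteq> C q"
      using 17 d_keys[of "frag_of b" "Suc q"] As_subset \<beta> by (auto simp: s')
    show ?case
    proof (cases "b = \<beta>")
      case True
      \<comment> \<open>The value of f' at d \<beta> is x \<gamma> - x \<gamma>.\<close>
      then show ?thesis using f'[OF order_refl db] y\<beta> by (simp add: \<gamma>)
    next
      case False
      then show ?thesis using f'[OF order_refl db] f_d_As[of b] 17 y0 by (simp add: s')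
    qed
  next
    case (18 b)
    have db: "Poly_Mapping.keys (d (Suc q) (frag_of b)) \<subseteq> C q"
      using 18 d_keys[of "frag_of b" "Suc q"] As_subset \<beta> by (auto simp: s')
    show ?case
    proof (cases "b = \<beta>")
      case True
      \<comment> \<open>Here \<phi>' d \<beta> = x \<phi> d \<beta> + x (\<lambda> \<beta> - \<phi>
        d \<beta>), and \<phi> d \<beta> cancels.\<close>
      then show ?thesis
        using phi'[OF order_refl db] y\<beta>
        by (simp add: \<gamma>'_def algL_cycle_def frag_cmul_diff_distrib2 s')
    next
      case False
      then show ?thesis
        using phi'[OF order_refl db] phi_d_As[of b] f_d_As[of b] 18 y0 by (simp add: s')
    qed
  qed
  then show ?thesis by (simp add: s'_def)
qed

text \<open>Degree \<open>Suc q\<close> is spanned by the eliminated elements, where f is 0, and the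
  remaining ones, where f is the identity. As \<phi> is 0 in this degree, the homotopy equation
  becomes \<lambda> c - g f c = \<phi> d c and can be checked on each kind of basis element.\<close>

lemma adjoin:
  assumes "algL_M C d (Suc q) s = {}"
  shows "algL_invariant n C d (Suc q) (algL_adjoin C d (Suc q) s)"
proof -
  define s' where "s' = algL_adjoin C d (Suc q) s"
  define N where "N = C (Suc q) - As s (Suc q)"
  have H: "Hs s (Suc q) = {}" by (simp add: Hs_above)
  have s': "lam s' = lam s" "Hs s' = (Hs s)(Suc q := N)"
      "As s' = (As s)(Suc q := As s (Suc q) \<union> N)"
    by (simp_all add: s'_def algL_adjoin_def N_def Let_def H)
  have fs': "fs s' r b = (if r = Suc q \<and> b \<in> N then frag_of b else fs s r b)"
    and gs': "gs s' r b = (if r = Suc q \<and> b \<in> N then algL_cycle d (Suc q) s b else gs s r b)"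
    and phis': "phis s' r b = (if r = Suc q \<and> b \<in> N then 0 else phis s r b)" for r b
    by (simp_all add: s'_def algL_adjoin_def N_def Let_def)
  have old: "fs s' r = fs s r" "gs s' r = gs s r" if "r \<noteq> Suc q" for r
    using that by (simp_all add: fun_eq_iff fs' gs')
  \<comment> \<open>The value 0 assigned to \<phi> on new elements is the one already
    stored.\<close>
  have phi: "phis s' r = phis s r" for r
    by (auto simp: fun_eq_iff phis' phis_above)
  have fd_basis: "frag_extend (fs s q) (d (Suc q) (frag_of b)) = 0" if b: "b \<in> C (Suc q)" for b
  proof -
    have "Poly_Mapping.keys (d (Suc q) (frag_of b)) \<subseteq> C q"
      using d_keys[of "frag_of b" "Suc q"] b by simp
    then have "Poly_Mapping.keys (algL_fd d (Suc q) s b) \<subseteq> Hs s q"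
      by (simp add: algL_fd_def f_keys)
    moreover have "Poly_Mapping.lookup (algL_fd d (Suc q) s b) c' = 0" if "c' \<in> Hs s q" for c'
      using assms b that by (auto simp: algL_M_def)
    \<comment> \<open>Coefficients outside \<open>Hs s q\<close> vanish by \<open>f_keys\<close>,
      those inside because M is empty.\<close>
    ultimately have "Poly_Mapping.keys (algL_fd d (Suc q) s b) = {}"
      by (auto simp del: keys_eq_empty simp: in_keys_iff)
    then show ?thesis by (simp add: algL_fd_def)
  qed
  have fd: "frag_extend (fs s q) (d (Suc q) c) = 0" if "Poly_Mapping.keys c \<subseteq> C (Suc q)" for c
    unfolding d_expand[OF that] frag_extend_frag_extend
    by (rule frag_extend_eq_0) (use that fd_basis in blast)
  have f_new: "frag_extend (fs s' (Suc q)) c = 0" if "Poly_Mapping.keys c \<subseteq> As s (Suc q)" for c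
    using that by (intro frag_extend_eq_0) (auto simp: fs' N_def fs_above)
  have f_id: "frag_extend (fs s' (Suc q)) c = c" if "Poly_Mapping.keys c \<subseteq> N" for c
  proof -
    have "frag_extend (fs s' (Suc q)) c = frag_extend frag_of c"
      using that by (intro frag_extend_eq) (auto simp: fs')
    then show ?thesis using frag_expansion by metis
  qed
  have g_new: "frag_extend (gs s' (Suc q)) c
      = frag_cmul (lam s) c - frag_extend (phis s q) (d (Suc q) c)"
    if c: "Poly_Mapping.keys c \<subseteq> N" for c
  proof -
    have cC: "Poly_Mapping.keys c \<subseteq> C (Suc q)" using c by (auto simp: N_def)
    have "frag_extend (gs s' (Suc q)) c = frag_extend (algL_cycle d (Suc q) s) c"
      using c by (intro frag_extend_eq) (auto simp: gs')
    then show ?thesis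
      unfolding d_expand[OF cC] frag_extend_frag_extend algL_cycle_def
      by (simp add: frag_extend_diff_fun frag_extend_cmul_of)
  qed
  have phid_keys: "Poly_Mapping.keys (frag_extend (phis s q) (d (Suc q) c)) \<subseteq> As s (Suc q)"
    if "Poly_Mapping.keys c \<subseteq> C (Suc q)" for c
    using d_keys[OF that] by (intro phi_keys_As) simp
  have N: "N \<subseteq> C (Suc q)" by (auto simp: N_def)
  \<comment> \<open>The invariant for \<open>Suc q\<close> speaks of A in degree
    \<open>q + 2\<close>, where nothing has been treated; its clauses on elements of A are
    vacuous.\<close>
  have As0: "As s (Suc (Suc q)) = {}" by (simp add: As_above)
  have "algL_invariant n C d (Suc q) s'"
  proof (unfold_locales, goal_cases)
    case 1
    show ?case using lam_nonzero by (simp add: s')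
  next
    case (2 r)
    show ?case using Hs_subset[of r] N by (simp add: s')
  next
    case (3 r)
    then show ?case using Hs_above by (simp add: s')
  next
    case 4
    show ?case by (simp add: s' As0)
  next
    case (5 r)
    then show ?case using As_above by (simp add: s')
  next
    case (6 r b)
    then show ?case using fs_above by (simp add: fs')
  next
    case (7 r b)
    then show ?case using phis_above by (simp add: phis')
  next
    case (8 c r)
    show ?case
    proof (cases "r = Suc q")
      case True
      have "Poly_Mapping.keys (fs s' (Suc q) b) \<subseteq> N" for b
        by (simp add: fs' fs_above)
      then show ?thesis using True by (simp add: s' keys_frag_extend_subset)
    next
      case False
      then show ?thesis using f_keys[OF 8] by (simp add: s' old)
    qed
  next
    case (9 c r)
    show ?case
    proof (cases "r = Suc q")
      case True
      then have "Poly_Mapping.keys c \<subseteq> N" using 9 by (simp add: s')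
      moreover have "Poly_Mapping.keys (algL_cycle d (Suc q) s b) \<subseteq> C (Suc q)" if "b \<in> N" for b
        using cycle_keys[of b] that N As_subset by blast
      ultimately show ?thesis
        using True by (intro keys_frag_extend_subset) (simp add: gs' subsetD)
    next
      case False
      then show ?thesis using g_keys 9 by (simp add: s' old)
    qed
  next
    case (10 c r)
    then show ?case using phi_keys by (simp add: phi)
  next
    case (11 c)
    then show ?case by (simp add: phi phi_above)
  next
    case (12 c r)
    consider "r = q" | "r < q" | "q < r" by linarith
    then show ?case
    proof cases
      case 1
      \<comment> \<open>The values of \<phi> in degree \<open>q\<close> are chains in eliminated
        elements, which the new f kills.\<close>
      then show ?thesis using 12 f_new phi_keys_As by (simp add: phi)
    next
      case 2
      then show ?thesis using 12 f_phi by (simp add: phi old)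
    next
      case 3
      then show ?thesis by (simp add: phi phi_above)
    qed
  next
    case (13 r c)
    then show ?case using fd f_d[of r c] by (cases "r = q") (simp_all add: old)
  next
    case (14 c r)
    show ?case
    proof (cases "r = Suc q")
      case True
      then have c: "Poly_Mapping.keys c \<subseteq> N" using 14 by (simp add: s')
      \<comment> \<open>In f g c = \<lambda> f c - f \<phi> d c the last term vanishes, since \<phi>
        d c is a chain in eliminated elements.\<close>
      then have "frag_extend (fs s' (Suc q)) (frag_extend (phis s q) (d (Suc q) c)) = 0"
        using N by (intro f_new phid_keys) simp
      then show ?thesis
        using True c by (simp add: g_new frag_extend_diff frag_extend_cmul f_id s')
    next
      case False
      then show ?thesis using f_g 14 by (simp add: s' old)
    qed
  next
    case (15 c r)
    show ?case
    proof (cases "r = Suc q")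
      case True
      then have c: "Poly_Mapping.keys c \<subseteq> N" using 15 by (simp add: s')
      then have cC: "Poly_Mapping.keys c \<subseteq> C (Suc q)" using N by simp
      have dc: "Poly_Mapping.keys (d (Suc q) c) \<subseteq> C q" using d_keys[OF cC] by simp
      have "d (Suc q) (frag_cmul (lam s) c - frag_extend (phis s q) (d (Suc q) c))
          = frag_cmul (lam s) (d (Suc q) c) - d (Suc q) (frag_extend (phis s q) (d (Suc q) c))"
        using cC phi_keys[OF dc] by (simp add: d_diff d_cmul keys_cmul_subset)
      \<comment> \<open>The homotopy equation at d c turns this into g f d c + \<phi> d d c, and
        both terms are 0.\<close>
      also have "\<dots> = 0"
        using homotopy[OF order_refl dc] fd[OF cC] d_d[OF cC] by simp
      finally show ?thesis using True c by (simp add: g_new)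
    next
      case False
      then show ?thesis using d_g 15 by (simp add: s' old)
    qed
  next
    case (16 r c)
    show ?case
    proof (cases "r = Suc q")
      case True
      have c: "Poly_Mapping.keys c \<subseteq> C (Suc q)" using 16 True by simp
      \<comment> \<open>On \<open>N\<close> this is the definition of g. On an eliminated
        \<open>b\<close> it reads \<lambda> b = \<phi> d b, because f b = 0.\<close>
      have *: "frag_cmul (lam s) (frag_of b) - frag_extend (gs s' (Suc q)) (fs s' (Suc q) b)
          = frag_extend (phis s q) (d (Suc q) (frag_of b))" if "b \<in> C (Suc q)" for b
      proof (cases "b \<in> N")
        case True
        then show ?thesis using g_new[of "frag_of b"] by (simp add: fs')
      next
        case False
        then show ?thesis using that phi_d_As[of b] by (simp add: fs' fs_above N_def)
      qed
      have "frag_cmul (lam s) c - frag_extend (gs s' (Suc q)) (frag_extend (fs s' (Suc q)) c)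
          = frag_extend (\<lambda>b. frag_cmul (lam s) (frag_of b)
              - frag_extend (gs s' (Suc q)) (fs s' (Suc q) b)) c"
        by (simp add: frag_extend_diff_fun frag_extend_cmul_of frag_extend_frag_extend)
      also have "\<dots> = frag_extend (\<lambda>b. frag_extend (phis s q) (d (Suc q) (frag_of b))) c"
        using c * by (intro frag_extend_eq) auto
      also have "\<dots> = frag_extend (phis s q) (d (Suc q) c)"
        by (simp add: d_expand[OF c] frag_extend_frag_extend)
      finally show ?thesis using True by (simp add: phi phi_above d_zero s')
    next
      case False
      then show ?thesis using homotopy 16 by (simp add: s' old phi)
    qed
  next
    case (17 b)
    then show ?case by (simp add: s' As0)
  next
    case (18 b)
    then show ?case by (simp add: s' As0)
  qed
  then show ?thesis by (simp add: s'_def)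
qed

text \<open>By \<open>Hs_above\<close> there is nothing to clear, so the loop of the next pass
  starts from a state satisfying the invariant.\<close>

lemma clear: "algL_clear (Suc q) s = s"
proof -
  have "(Hs s)(Suc q := {}) = Hs s" by (simp add: fun_eq_iff Hs_above)
  then show ?thesis by (simp add: algL_clear_def)
qed

end

section \<open>The invariant along a run\<close>

context based_complex
begin

text \<open>For \<open>q = 0\<close> the clauses on A concern only degrees from 1 on, where A is
  empty; in degree 0 the maps f and g are identities and \<lambda> is 1.\<close>

lemma invariant_init: "algL_invariant n C d 0 (algL_init C)"
proof -
  have f: "frag_extend (fs (algL_init C) 0) c = c" "frag_extend (gs (algL_init C) 0) c = c"
    if "Poly_Mapping.keys c \<subseteq> C 0" for c
  proof -
    have "frag_extend (\<lambda>b. if b \<in> C 0 then frag_of b else 0) c = frag_extend frag_of c"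
      using that by (intro frag_extend_eq) auto
    then show "frag_extend (fs (algL_init C) 0) c = c" "frag_extend (gs (algL_init C) 0) c = c"
      using frag_expansion[of c] by (simp_all add: algL_init_def)
  qed
  have f0: "fs (algL_init C) r = (\<lambda>b. 0)" if "0 < r" for r
    using that by (simp add: algL_init_def)
  have phi: "phis (algL_init C) r = (\<lambda>b. 0)" for r
    by (simp add: algL_init_def)
  have z: "frag_extend (\<lambda>b. 0) c = 0" for c :: "'a \<Rightarrow>\<^sub>0 int"
    by (simp add: frag_extend_eq_0)
  have H: "Hs (algL_init C) r = (if r = 0 then C 0 else {})"
    "As (algL_init C) r = (if r = 0 then C 0 else {})" "lam (algL_init C) = 1" for r
    by (simp_all add: algL_init_def)
  show ?thesis
  proof (unfold_locales, goal_cases)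
    case (8 c r)
    then show ?case by (cases "r = 0") (simp_all add: f f0 z H)
  next
    case (9 c r)
    then show ?case by (cases "r = 0") (simp_all add: f H)
  next
    case (14 c r)
    then show ?case by (cases "r = 0") (simp_all add: f H)
  next
    case (15 c r)
    then show ?case by (cases "r = 0") (simp_all add: f H d_0 d_zero)
  next
    case (16 r c)
    then show ?case by (simp add: f phi z H d_zero)
  qed (simp_all add: H f0 phi z)
qed

lemma invariant_steps:
  assumes "(algL_step C d (Suc q))\<^sup>*\<^sup>* s s'" "algL_invariant n C d q s"
  shows "algL_invariant n C d q s'"
  using assms(1)
proof (induction rule: rtranclp_induct)
  case base
  show ?case by (rule assms(2))
next
  case (step t t')
  interpret algL_invariant n C d q t by (rule step.IH)
  from step.hyps(2) show ?case
  proof cases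
    case (1 \<alpha> \<beta>)
    have fin: "finite (C r)" for r
      using complex by (simp add: finite_chain_complex_def)
    \<comment> \<open>Finiteness makes \<open>Min\<close> an element of M, and M contains only
      non-zero numbers; hence x is non-zero.\<close>
    have "algL_M C d (Suc q) t \<subseteq> (\<lambda>(c, c'). \<bar>Poly_Mapping.lookup (algL_fd d (Suc q) t c) c'\<bar>)
        ` (C (Suc q) \<times> C q)"
      using Hs_subset[of q] by (auto simp: algL_M_def)
    then have "finite (algL_M C d (Suc q) t)"
      by (rule finite_subset) (simp add: fin)
    then have "Min (algL_M C d (Suc q) t) \<in> algL_M C d (Suc q) t"
      using 1 by simp
    then have "Poly_Mapping.lookup (algL_fd d (Suc q) t \<beta>) \<alpha> \<noteq> 0"
      using 1 by (auto simp: algL_M_def)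
    then show ?thesis using 1 eliminate by simp
  qed
qed

lemma invariant_run:
  assumes "algL_run C d q s"
  shows "algL_invariant n C d q s"
  using assms
proof induction
  case init
  show ?case by (rule invariant_init)
next
  case (pass q s s')
  \<comment> \<open>Pass \<open>q\<close> works under the invariant for \<open>q - 1\<close>;
    adjoining raises its index to \<open>q\<close>.\<close>
  then obtain p where q: "q = Suc p" by (cases q) auto
  interpret s: algL_invariant n C d p s using pass.IH q by simp
  have "algL_invariant n C d p s'"
    using pass.hyps(3) s.clear s.algL_invariant_axioms invariant_steps q by simp
  then show ?case
    using algL_invariant.adjoin pass.hyps(4) q by blast
qed

end

section \<open>From the invariant after pass \<open>n\<close> to the AT-model\<close>

theorem theorem4p10:
  fixes n :: nat
    and C :: "nat \<Rightarrow> 'a set"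
    and d f g \<phi> :: "nat \<Rightarrow> ('a \<Rightarrow>\<^sub>0 int) \<Rightarrow> ('a \<Rightarrow>\<^sub>0 int)"
    and H :: "nat \<Rightarrow> 'a set"
    and l :: int
  assumes "finite_chain_complex n C d"
    and "algL_output n C d H f g \<phi> l"
  shows "AT_model n C d H f g \<phi> l"
proof -
  from assms(2) obtain s where run: "algL_run C d n s"
    and out: "H = Hs s" "f = (\<lambda>q. frag_extend (fs s q))" "g = (\<lambda>q. frag_extend (gs s q))"
      "\<phi> = (\<lambda>q. frag_extend (phis s q))" "l = lam s"
    by (auto simp: algL_output_def)
  interpret based_complex n C d by unfold_locales (rule assms(1))
  interpret algL_invariant n C d n s using invariant_run[OF run] .
  have fin: "finite (C r)" and top: "n < r \<Longrightarrow> C r = {}" for r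
    using assms(1) by (simp_all add: finite_chain_complex_def)
  \<comment> \<open>This makes f a chain map to zero differential. The invariant gives it for
    degrees 1 to \<open>n\<close>; in degree 0 the boundary is 0, and above \<open>n\<close> the
    only chain is 0.\<close>
  have f_d': "frag_extend (fs s (r - 1)) (d r c) = 0" if c: "Poly_Mapping.keys c \<subseteq> C r" for r c
  proof (cases r)
    case 0
    then show ?thesis using c d_0 by simp
  next
    case (Suc k)
    show ?thesis
    proof (cases "r \<le> n")
      case False
      then have "c = 0" using c top[of r] by simp
      then show ?thesis by (simp add: d_zero)
    qed (use Suc c f_d in simp)
  qed
  have homotopy': "frag_cmul (lam s) c - frag_extend (gs s r) (frag_extend (fs s r) c)
        = frag_extend (phis s (r - 1)) (d r c) + d (r + 1) (frag_extend (phis s r) c)"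
    if c: "Poly_Mapping.keys c \<subseteq> C r" for r c
  proof (cases "r \<le> n")
    case False
    then have "c = 0" using c top[of r] by simp
    then show ?thesis by (simp add: d_zero)
  qed (use c homotopy in simp)
  have "(\<lambda>c. 0) \<in> hom (chains H r) (chains H (r - 1))" for r
    by (rule homI) simp_all
  moreover have "finite (H r)" for r
    unfolding out using Hs_subset fin by (rule finite_subset)
  ultimately have "finite_chain_complex n H (\<lambda>q c. 0)"
    using Hs_above by (simp add: finite_chain_complex_def out)
  moreover have "chain_map C d H (\<lambda>q c. 0) f"
    unfolding chain_map_def out using f_d' by (simp add: frag_extend_in_hom f_keys)
  moreover have "chain_map H (\<lambda>q c. 0) C d g"
    unfolding chain_map_def out using d_g by (simp add: frag_extend_in_hom g_keys)
  moreover have "\<phi> r \<in> hom (chains C r) (chains C (r + 1))" for r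
    unfolding out by (simp add: frag_extend_in_hom phi_keys)
  ultimately show ?thesis
    using assms(1) lam_nonzero f_g homotopy'
    by (simp add: AT_model_def chain_contraction_def out)
qed

end
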